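(* Let $n,p$ be positive coprime integers and let $\omega\in\widetilde{\mathfrak S}_n$ be a dominant $p$-stable affine permutation. Then $t^p_{i,j}(\omega)=d_{i,j}(\mathcal A(\omega))$ for all $i,j\in[n]$ with $i<j$; that is, the rational Shi tableau of $\omega$ equals the codinv tableau of the rational Dyck path $\mathcal A(\omega)$.
   Context: Affine permutations: $\widetilde{\mathfrak S}_n$ is the group of bijections $\omega:\mathbb Z\to\mathbb Z$ with $\omega(i+n)=\omega(i)+n$ and $\omega(1)+\dots+\omega(n)=n(n+1)/2$. $\omega$ is dominant if $\omega^{-1}(1)<\dots<\omega^{-1}(n)$, and $p$-stable if $\omega(i)<\omega(i+p)$ for all $i$. For $i<j$ in $[n]$ let $k_{i,j}(\omega)=|\lfloor(\omega^{-1}(j)-\omega^{-1}(i))/n\rfloor|$; let $s\in\mathfrak S_n$ with $s(i)\equiv\omega^{-1}(i)\pmod n$; write $p=mn+r$, $m\ge0$, $r\in[n-1]$ (when $n\ge 2$). The rational Shi tableau: $t^p_{i,j}(\omega)=\min(k_{i,j}(\omega),m)$ if $r+s(i)<s(j)$ or $s(i)+r-n<s(j)<s(i)$, and $\min(k_{i,j}(\omega),m+1)$ otherwise. Rational Dyck paths: a rational Dyck path is a lattice path from $(0,0)$ with $n$ North steps $(0,1)$ and $p$ East steps $(1,0)$ never going below the line of slope $n/p$ through the origin; $\mathfrak D_{n,p}$ is the set of these. The unit square with bottom-right corner $(i,j)$ gets label $\ell_{i,j}=jp-in$; each step of a path gets the label $\ell_{i,j}$ of its starting point $(i,j)$. Let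 $\ell_1<\ell_2<\dots<\ell_n$ be the labels of the North steps of $x$. Let $H(x)$ be the set of positive labels of unit squares lying below $x$ (i.e. between $x$ and the diagonal). The codinv tableau of $x$ is $d_{i,j}(x)=\#\{h\in H(x):\ell_i<h<\ell_i+p,\ h\equiv\ell_j \pmod n\}$ for $i<j$ in $[n]$. Anderson map: for a finite set $H$ of positive integers there is a unique partition whose first-column cells have hook lengths exactly $H$; let $\varphi(x)$ be the partition with first-column hook length set $H(x)$. By Anderson's theorem, $\varphi$ is a bijection from $\mathfrak D_{n,p}$ to the set of $n,p$-cores (partitions with no hook length equal to $n$ or $p$). For a partition $\kappa$ let $\alpha(\kappa)=\{\kappa_i+1-i:i\ge1\}$ (with $\kappa_i=0$ for $i>\ell(\kappa)$), and for dominant $\omega$ let $\gamma(\omega)=\{z\in\mathbb Z:\omega(z)\le0\}$. For dominant $p$-stable $\omega$ there is a unique $n,p$-core $\kappa$ with $\alpha(\kappa)=\gamma(\omega)$, and $\mathcal A(\omega)=\varphi^{-1}(\kappa)$. *)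

theory Defs
  imports "HOL-Number_Theory.Cong" "HOL-Combinatorics.Permutations"
begin

section \<open>Affine permutations and the rational Shi tableau\<close>

definition affine_permutations :: "nat \<Rightarrow> (int \<Rightarrow> int) set" where
  "affine_permutations n =
     {\<omega>. bij \<omega> \<and> (\<forall>i. \<omega> (i + int n) = \<omega> i + int n) \<and>
         (\<Sum>i\<in>{1..int n}. \<omega> i) = int (n * (n + 1) div 2)}"

definition dominant :: "nat \<Rightarrow> (int \<Rightarrow> int) \<Rightarrow> bool" where
  "dominant n \<omega> \<longleftrightarrow> strict_mono_on {1..int n} (inv \<omega>)"

definition p_stable :: "nat \<Rightarrow> (int \<Rightarrow> int) \<Rightarrow> bool" where
  "p_stable p \<omega> \<longleftrightarrow> (\<forall>i. \<omega> i < \<omega> (i + int p))"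

definition shi_k :: "nat \<Rightarrow> (int \<Rightarrow> int) \<Rightarrow> nat \<Rightarrow> nat \<Rightarrow> nat" where
  "shi_k n \<omega> i j = nat \<bar>(inv \<omega> (int j) - inv \<omega> (int i)) div int n\<bar>"

definition residue_perm :: "nat \<Rightarrow> (int \<Rightarrow> int) \<Rightarrow> nat \<Rightarrow> nat" where
  "residue_perm n \<omega> =
     (THE s. s permutes {1..n} \<and> (\<forall>i\<in>{1..n}. [int (s i) = inv \<omega> (int i)] (mod int n)))"

text \<open>For coprime \<open>n \<ge> 2\<close> and \<open>p\<close>, the decomposition \<open>p = m * n + r\<close> with
  \<open>1 \<le> r \<le> n - 1\<close> is given by \<open>m = p div n\<close> and \<open>r = p mod n\<close>.\<close>

definition shi_tableau :: "nat \<Rightarrow> nat \<Rightarrow> (int \<Rightarrow> int) \<Rightarrow> nat \<Rightarrow> nat \<Rightarrow> nat" where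
  "shi_tableau n p \<omega> i j =
     (let m = p div n; r = p mod n; s = residue_perm n \<omega> in
      if r + s i < s j \<or> (int (s i) + int r - int n < int (s j) \<and> s j < s i)
      then min (shi_k n \<omega> i j) m
      else min (shi_k n \<omega> i j) (m + 1))"


section \<open>Rational Dyck paths and the codinv tableau\<close>

datatype step = North | East

definition end_point :: "step list \<Rightarrow> nat \<times> nat" where
  "end_point x = (count_list x East, count_list x North)"

definition dyck_paths :: "nat \<Rightarrow> nat \<Rightarrow> step list set" where
  "dyck_paths n p =
     {x. count_list x North = n \<and> count_list x East = p \<and>
         (\<forall>k \<le> length x. case end_point (take k x) of (i, j) \<Rightarrow> n * i \<le> p * j)}"

definition label :: "nat \<Rightarrow> nat \<Rightarrow> nat \<times> nat \<Rightarrow> int" where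
  "label n p = (\<lambda>(i, j). int j * int p - int i * int n)"

definition north_starts :: "step list \<Rightarrow> (nat \<times> nat) set" where
  "north_starts x = {end_point (take k x) | k. k < length x \<and> x ! k = North}"

text \<open>\<open>north_label n p x i\<close> is the \<open>i\<close>-th smallest label of a North step, counting from \<open>1\<close>.\<close>

definition north_label :: "nat \<Rightarrow> nat \<Rightarrow> step list \<Rightarrow> nat \<Rightarrow> int" where
  "north_label n p x i = sorted_list_of_set (label n p ` north_starts x) ! (i - 1)"

text \<open>A unit square is represented by its bottom-right corner \<open>(i, j)\<close>, so it occupies
  \<open>[i - 1, i] \<times> [j, j + 1]\<close>. It lies below \<open>x\<close> iff the North step of \<open>x\<close> from height \<open>j\<close>
  to \<open>j + 1\<close> has abscissa \<open>a \<le> i - 1\<close>. Its label is positive iff that corner, hence the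
  whole square, lies above the diagonal.\<close>

definition squares_below :: "step list \<Rightarrow> (nat \<times> nat) set" where
  "squares_below x = {(i, j). \<exists>a. (a, j) \<in> north_starts x \<and> a < i}"

definition pos_labels_below :: "nat \<Rightarrow> nat \<Rightarrow> step list \<Rightarrow> int set" where
  "pos_labels_below n p x = {h \<in> label n p ` squares_below x. 0 < h}"

definition codinv_tableau :: "nat \<Rightarrow> nat \<Rightarrow> step list \<Rightarrow> nat \<Rightarrow> nat \<Rightarrow> nat" where
  "codinv_tableau n p x i j =
     card {h \<in> pos_labels_below n p x.
             north_label n p x i < h \<and> h < north_label n p x i + int p \<and>
             [h = north_label n p x j] (mod int n)}"


section \<open>Partitions, cores and the Anderson map\<close>

definition partitions :: "nat list set" where
  "partitions = {\<kappa>. sorted_wrt (\<ge>) \<kappa> \<and> 0 \<notin> set \<kappa>}"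

text \<open>Parts are indexed from \<open>1\<close> and vanish beyond the length.\<close>

definition part :: "nat list \<Rightarrow> nat \<Rightarrow> nat" where
  "part \<kappa> i = (if 1 \<le> i \<and> i \<le> length \<kappa> then \<kappa> ! (i - 1) else 0)"

definition cells :: "nat list \<Rightarrow> (nat \<times> nat) set" where
  "cells \<kappa> = {(i, j). 1 \<le> i \<and> i \<le> length \<kappa> \<and> 1 \<le> j \<and> j \<le> part \<kappa> i}"

definition conj_part :: "nat list \<Rightarrow> nat \<Rightarrow> nat" where
  "conj_part \<kappa> j = card {i. (i, j) \<in> cells \<kappa>}"

definition hook_length :: "nat list \<Rightarrow> nat \<times> nat \<Rightarrow> nat" where
  "hook_length \<kappa> = (\<lambda>(i, j). (part \<kappa> i - j) + (conj_part \<kappa> j - i) + 1)"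

definition first_column_hooks :: "nat list \<Rightarrow> nat set" where
  "first_column_hooks \<kappa> = {hook_length \<kappa> (i, 1) | i. (i, 1) \<in> cells \<kappa>}"

definition cores :: "nat \<Rightarrow> nat \<Rightarrow> nat list set" where
  "cores n p = {\<kappa> \<in> partitions. \<forall>c \<in> cells \<kappa>. hook_length \<kappa> c \<noteq> n \<and> hook_length \<kappa> c \<noteq> p}"

definition anderson_core :: "nat \<Rightarrow> nat \<Rightarrow> step list \<Rightarrow> nat list" where
  "anderson_core n p x =
     (THE \<kappa>. \<kappa> \<in> partitions \<and> int ` first_column_hooks \<kappa> = pos_labels_below n p x)"

definition partition_abacus :: "nat list \<Rightarrow> int set" where
  "partition_abacus \<kappa> = {int (part \<kappa> i) + 1 - int i | i. 1 \<le> i}"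

definition affine_abacus :: "(int \<Rightarrow> int) \<Rightarrow> int set" where
  "affine_abacus \<omega> = {z. \<omega> z \<le> 0}"

definition anderson_map :: "nat \<Rightarrow> nat \<Rightarrow> (int \<Rightarrow> int) \<Rightarrow> step list" where
  "anderson_map n p \<omega> =
     the_inv_into (dyck_paths n p) (anderson_core n p)
       (THE \<kappa>. \<kappa> \<in> cores n p \<and> partition_abacus \<kappa> = affine_abacus \<omega>)"

end

theory Submission
  imports Defs
begin

text \<open>Put \<open>w = inv \<omega>\<close>. The set \<open>G = {h. \<omega> (h + w 1) \<le> 0}\<close> contains all negative integers but not
  \<open>0\<close>, and is closed under subtracting \<open>n\<close> and \<open>p\<close>. Its positive part is both the set of first-column
  hook lengths of the core attached to \<open>\<omega>\<close> and the set of labels below the Dyck path \<open>x = \<A>(\<omega>)\<close>. The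
  labels of the North steps of \<open>x\<close> are the least non-elements of \<open>G\<close> in the residue classes
  modulo \<open>n\<close>, which are the numbers \<open>w i - w 1\<close>. Hence \<open>d i j\<close> counts the \<open>h < w j - w 1\<close> congruent
  to \<open>w j - w 1\<close> that lie strictly between \<open>w i - w 1\<close> and \<open>w i - w 1 + p\<close>. With
  \<open>w j - w i = q * n + e\<close> and \<open>p = m * n + r\<close> this number is \<open>min q m\<close> or \<open>min q (m + 1)\<close> according to
  whether \<open>e \<ge> r\<close> or \<open>e < r\<close>.\<close>

section \<open>Lattice paths\<close>

lemma end_point_snoc [simp]:
  "end_point (x @ [North]) = (fst (end_point x), Suc (snd (end_point x)))"
  "end_point (x @ [East]) = (Suc (fst (end_point x)), snd (end_point x))"
  by (auto simp: end_point_def)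

lemma north_starts_snoc:
  "north_starts (x @ [s]) = (if s = North then insert (end_point x) else id) (north_starts x)"
proof -
  have "north_starts (x @ [s]) =
      {end_point (take k (x @ [s])) | k. k < length x \<and> (x @ [s]) ! k = North} \<union>
      {end_point (take k (x @ [s])) | k. k = length x \<and> (x @ [s]) ! k = North}"
  proof -
    have "k < length (x @ [s]) \<longleftrightarrow> k < length x \<or> k = length x" for k by auto
    then show ?thesis unfolding north_starts_def by blast
  qed
  also have "{end_point (take k (x @ [s])) | k. k < length x \<and> (x @ [s]) ! k = North} = north_starts x"
    unfolding north_starts_def by (force simp: nth_append)
  also have "{end_point (take k (x @ [s])) | k. k = length x \<and> (x @ [s]) ! k = North} =
      (if s = North then {end_point x} else {})"
    by auto
  finally show ?thesis by auto
qed

lemma north_starts_Nil [simp]: "north_starts [] = {}"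
  by (simp add: north_starts_def)

lemma north_starts_snoc_North [simp]:
  "north_starts (x @ [North]) = insert (end_point x) (north_starts x)"
  by (simp add: north_starts_snoc)

lemma north_starts_snoc_East [simp]: "north_starts (x @ [East]) = north_starts x"
  by (simp add: north_starts_snoc)

lemma north_starts_append_replicate_East [simp]:
  "north_starts (x @ replicate k East) = north_starts x"
proof (induction k)
  case (Suc k)
  have "x @ replicate (Suc k) East = (x @ replicate k East) @ [East]"
    by (simp add: replicate_append_same)
  then show ?case using Suc by (metis north_starts_snoc_East)
qed simp

lemma north_starts_bound:
  "(a, j) \<in> north_starts x \<Longrightarrow> a \<le> count_list x East \<and> j < count_list x North"
proof (induction x rule: rev_induct)
  case (snoc s x)
  then show ?case by (cases s) (auto simp: end_point_def)
qed simp

text \<open>Each height is left by exactly one North step, so abscissas are a function of height.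
  Appending a North step defines this function at one new height; an East step leaves it
  alone.\<close>

lemma north_starts_graph:
  "\<exists>a. north_starts x = (\<lambda>j. (a j, j)) ` {..<count_list x North}"
proof (induction x rule: rev_induct)
  case (snoc s x)
  then obtain a where a: "north_starts x = (\<lambda>j. (a j, j)) ` {..<count_list x North}" by blast
  show ?case
  proof (cases s)
    case North
    let ?a = "a(count_list x North := count_list x East)"
    have "north_starts (x @ [s]) = (\<lambda>j. (?a j, j)) ` {..<count_list (x @ [s]) North}"
      using North a by (auto simp: end_point_def lessThan_Suc)
    then show ?thesis by blast
  next
    case East
    then show ?thesis using a by auto
  qed
qed simp

text \<open>The end point and the North starts determine the last step, which can then be removed
  from both paths.\<close>

lemma path_eqI:
  "end_point x = end_point y \<Longrightarrow> north_starts x = north_starts y \<Longrightarrow> x = y"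
proof (induction x arbitrary: y rule: rev_induct)
  case Nil
  then show ?case
    by (cases y rule: rev_cases; cases "last y") (auto simp: end_point_def)
next
  case (snoc s x)
  have "\<exists>y'. y = y' @ [s]"
  proof (cases y rule: rev_cases)
    case Nil
    then show ?thesis using snoc.prems by (cases s) (auto simp: end_point_def)
  next
    case (snoc y' t)
    show ?thesis
    proof (cases s; cases t)
      \<comment> \<open>The last North step of \<open>x @ [s]\<close> would start at an abscissa
        that \<open>y'\<close> has not yet reached.\<close>
      assume "s = North" "t = East"
      with snoc.prems snoc have "(count_list x East, count_list x North) \<in> north_starts y'"
          "count_list x East = Suc (count_list y' East)"
        by (auto simp: end_point_def)
      then show ?thesis using north_starts_bound by fastforce
    next
      assume "s = East" "t = North"
      with snoc.prems snoc have "(count_list y' East, count_list y' North) \<in> north_starts x"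
          "count_list y' East = Suc (count_list x East)"
        by (auto simp: end_point_def)
      then show ?thesis using north_starts_bound by fastforce
    qed (use snoc in auto)
  qed
  then obtain y' where y': "y = y' @ [s]" by blast
  have e: "end_point x = end_point y'"
    using snoc.prems(1) y' by (cases s) (auto simp: end_point_def)
  \<comment> \<open>In the North case the same new point is inserted on both sides; since it is new,
    it can be cancelled.\<close>
  have "end_point z \<notin> north_starts z" for z
    using north_starts_bound by (fastforce simp: end_point_def)
  with snoc.prems(2) y' e have "north_starts x = north_starts y'"
    by (cases s) (simp_all, metis insert_ident)
  with e y' snoc.IH show ?case by blast
qed

lemma dyck_paths_north_starts_le:
  assumes "x \<in> dyck_paths n p" "(a, j) \<in> north_starts x"
  shows "n * a \<le> p * j"
proof -
  obtain k where "k < length x" "end_point (take k x) = (a, j)"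
    using assms(2) by (auto simp: north_starts_def)
  then show ?thesis
    using assms(1) unfolding dyck_paths_def by (smt (verit) case_prod_conv less_imp_le mem_Collect_eq)
qed

lemma dyck_paths_north_starts_graph:
  assumes "x \<in> dyck_paths n p"
  obtains a where "north_starts x = (\<lambda>j. (a j, j)) ` {..<n}" "\<And>j. j < n \<Longrightarrow> n * a j \<le> p * j"
proof -
  obtain a where a: "north_starts x = (\<lambda>j. (a j, j)) ` {..<n}"
    using north_starts_graph[of x] assms by (auto simp: dyck_paths_def)
  moreover have "n * a j \<le> p * j" if "j < n" for j
    using dyck_paths_north_starts_le[OF assms] a that by blast
  ultimately show ?thesis using that by blast
qed

text \<open>The North step from height \<open>j\<close> has abscissa \<open>a j\<close>, and the
  East run after it ends at abscissa \<open>a (j + 1)\<close>. The truncated difference is the true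
  one for monotone \<open>a\<close>.\<close>

fun staircase :: "(nat \<Rightarrow> nat) \<Rightarrow> nat \<Rightarrow> step list" where
  "staircase a 0 = []"
| "staircase a (Suc k) = (staircase a k @ [North]) @ replicate (a (Suc k) - a k) East"

lemma count_list_replicate: "count_list (replicate k s) t = (if s = t then k else 0)"
  by (induction k) auto

lemma count_list_staircase:
  assumes "a 0 = 0" "mono a"
  shows "count_list (staircase a k) North = k" "count_list (staircase a k) East = a k"
proof (induction k)
  case (Suc k)
  have "a k \<le> a (Suc k)" using assms(2) by (simp add: monoD)
  case 1 show ?case using Suc by (simp add: count_list_replicate)
  case 2 show ?case using Suc \<open>a k \<le> a (Suc k)\<close> by (simp add: count_list_replicate)
qed (use assms in auto)

lemma north_starts_staircase:
  assumes "a 0 = 0" "mono a"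
  shows "north_starts (staircase a k) = (\<lambda>j. (a j, j)) ` {..<k}"
  by (induction k)
    (auto simp del: append_assoc simp: end_point_def count_list_staircase[OF assms] lessThan_Suc)

text \<open>This reduces the Dyck condition on all prefixes to the points \<open>(a j, j)\<close>,
  the right ends of the horizontal runs.\<close>

lemma end_point_take_staircase:
  assumes "a 0 = 0" "mono a" "end_point (take l (staircase a k)) = (i, j)"
  shows "i \<le> a j \<and> j \<le> k"
  using assms(3)
proof (induction k arbitrary: i j)
  case 0
  then show ?case by (simp add: end_point_def)
next
  case (Suc k)
  show ?case
  proof (cases "l \<le> length (staircase a k)")
    case True
    then show ?thesis using Suc.IH[of i j] Suc.prems by simp
  next
    case False
    let ?r = "l - Suc (length (staircase a k))"
    \<comment> \<open>A longer prefix contains the smaller staircase, the next North step and a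
      truncated East run; the \<open>Suc\<close> in \<open>?r\<close> accounts for that North
      step.\<close>
    have "take l (staircase a (Suc k)) =
        staircase a k @ [North] @ replicate (min ?r (a (Suc k) - a k)) East"
      using False by (simp add: take_Cons' Suc_diff_le flip: diff_Suc_eq_diff_pred)
    moreover have "a k \<le> a (Suc k)" using assms(2) by (simp add: monoD)
    ultimately show ?thesis
      using Suc.prems by (auto simp: end_point_def count_list_staircase[OF assms(1,2)] count_list_replicate)
  qed
qed

lemma staircase_in_dyck_paths:
  assumes "a 0 = 0" "mono a" "a n = p" "\<And>j. j \<le> n \<Longrightarrow> n * a j \<le> p * j"
  shows "staircase a n \<in> dyck_paths n p"
proof -
  have "n * i \<le> p * j" if "end_point (take k (staircase a n)) = (i, j)" for k i j
    using end_point_take_staircase[OF assms(1,2) that] assms(4)[of j]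
    by (meson le_trans mult_le_mono2)
  then show ?thesis
    using count_list_staircase[OF assms(1,2)] assms(3) unfolding dyck_paths_def by auto
qed

section \<open>Labels of Dyck paths\<close>

text \<open>As \<open>p\<close> is invertible modulo \<open>n\<close>, distinct rows carry labels in
  distinct residue classes.\<close>

lemma coprime_multiples_cong_iff:
  assumes "coprime n p" "j < n" "j' < n"
  shows "[int j * int p = int j' * int p] (mod int n) \<longleftrightarrow> j = j'"
proof
  assume "[int j * int p = int j' * int p] (mod int n)"
  then have "[int j = int j'] (mod int n)"
    using assms(1) by (simp add: cong_mult_rcancel coprime_commute)
  then show "j = j'" using assms(2,3) by (simp add: cong_int_iff cong_less_modulus_unique_nat)
qed auto

lemma coprime_multiple_cong_exists:
  fixes z :: int
  assumes "0 < n" "coprime n p"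
  obtains j where "j < n" "[int j * int p = z] (mod int n)"
proof -
  obtain y where y: "[int p * y = 1] (mod int n)"
    using assms(2) cong_solve_coprime_int[of "int p" "int n"] by (auto simp: coprime_commute)
  \<comment> \<open>With \<open>y\<close> inverse to \<open>p\<close> modulo \<open>n\<close>, the
    row whose labels are congruent to \<open>z\<close> is \<open>y * z\<close>, reduced modulo
    \<open>n\<close>.\<close>
  define j where "j = nat ((y * z) mod int n)"
  have j: "int j = (y * z) mod int n" using assms(1) by (simp add: j_def)
  have "[int j * int p = (y * z) * int p] (mod int n)"
    unfolding j by (intro cong_mult) (auto simp: cong_def)
  also have "(y * z) * int p = (int p * y) * z" by simp
  also have "[(int p * y) * z = 1 * z] (mod int n)" by (intro cong_mult y) auto
  finally have "[int j * int p = z] (mod int n)" by simp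
  moreover have "j < n" using assms(1) by (simp add: j_def nat_less_iff)
  ultimately show ?thesis using that by blast
qed

lemma cong_multiple_diff:
  fixes z :: int
  assumes "[b = z] (mod int n)"
  obtains i where "z = b - i * int n"
proof -
  have "int n dvd b - z" using assms by (simp add: cong_iff_dvd_diff)
  then obtain i where "b - z = int n * i" by (rule dvdE)
  then have "z = b - i * int n" by (simp add: algebra_simps)
  then show ?thesis using that by blast
qed

lemma pos_labels_below_iff:
  assumes "north_starts x = (\<lambda>j. (a j, j)) ` {..<n}"
  shows "h \<in> pos_labels_below n p x \<longleftrightarrow>
    0 < h \<and> (\<exists>j<n. \<exists>i>a j. h = int j * int p - int i * int n)"
proof -
  have "squares_below x = {(i, j). j < n \<and> a j < i}"
    unfolding squares_below_def assms by auto
  then show ?thesis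
    unfolding pos_labels_below_def label_def image_iff by auto
qed

lemma finite_pos_labels_below:
  assumes "x \<in> dyck_paths n p"
  shows "finite (pos_labels_below n p x)"
proof -
  obtain a where a: "north_starts x = (\<lambda>j. (a j, j)) ` {..<n}"
    using dyck_paths_north_starts_graph[OF assms] by blast
  have "int j * int p - int i * int n \<le> int n * int p" if "j < n" for i j
    using that by (smt (verit) mult_right_mono of_nat_0_le_iff of_nat_less_iff zero_le_mult_iff)
  then have "pos_labels_below n p x \<subseteq> {0..int n * int p}"
    unfolding subset_iff pos_labels_below_iff[OF a] by fastforce
  then show ?thesis using finite_subset by blast
qed

text \<open>The rows run through all residue classes modulo \<open>n\<close>, and labels drop by
  \<open>n\<close> with each step to the right. In row \<open>j\<close> the set \<open>G\<close>
  consists of the labels strictly to the right of the North step, whose own label is therefore the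
  least one outside \<open>G\<close>.\<close>

lemma north_labels_eq:
  assumes "0 < n" "coprime n p" "x \<in> dyck_paths n p"
  defines "G \<equiv> pos_labels_below n p x \<union> {..<0}"
  shows "label n p ` north_starts x = {z. z \<notin> G \<and> z - int n \<in> G}"
proof -
  obtain a where a: "north_starts x = (\<lambda>j. (a j, j)) ` {..<n}"
    and le: "\<And>j. j < n \<Longrightarrow> n * a j \<le> p * j"
    using dyck_paths_north_starts_graph[OF assms(3)] by blast
  let ?l = "\<lambda>j i. int j * int p - i * int n"
  have nonneg: "0 \<le> ?l j (int (a j))" if "j < n" for j
    using le[OF that] by (metis diff_ge_0_iff_ge mult.commute of_nat_le_iff of_nat_mult)
  have l_eq: "j = j' \<and> i = i'" if "?l j i = ?l j' i'" "j < n" "j' < n" for j j' i i'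
  proof -
    have "int j * int p = (i - i') * int n + int j' * int p"
      using that(1) by (simp add: algebra_simps)
    then have "[int j * int p = int j' * int p] (mod int n)"
      by (simp add: cong_def)
    then have "j = j'" using coprime_multiples_cong_iff assms(2) that(2,3) by blast
    then show ?thesis using that(1) assms(1) by simp
  qed
  have l_0: "i = 0" if "?l j i = 0" "j < n" for j i
    using l_eq[of j i 0 0] that assms(1) by simp
  have G: "?l j i \<in> G \<longleftrightarrow> int (a j) < i" if "j < n" for j i
  proof
    assume "?l j i \<in> G"
    then consider "?l j i < 0"
      | j' i' where "j' < n" "a j' < i'" "?l j i = ?l j' (int i')"
      by (auto simp: G_def pos_labels_below_iff[OF a])
    then show "int (a j) < i"
    proof cases
      case 1
      then have "int (a j) * int n < i * int n" using nonneg[OF that] by linarith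
      then show ?thesis using assms(1) by simp
    next
      case 2
      then show ?thesis using l_eq[of j i j' "int i'"] that by simp
    qed
  next
    assume *: "int (a j) < i"
    \<comment> \<open>By coprimality the origin is the only point with label 0 in the rows below
      \<open>n\<close>. Right of the North step a label is thus negative or the positive label of a
      square below \<open>x\<close>.\<close>
    then have "?l j i \<noteq> 0" using l_0[of j i] that by auto
    moreover have "?l j i \<in> pos_labels_below n p x" if "0 < ?l j i"
      unfolding pos_labels_below_iff[OF a] using * that \<open>j < n\<close>
      by (intro conjI exI[of _ j] exI[of _ "nat i"]) auto
    ultimately show "?l j i \<in> G" by (auto simp: G_def)
  qed
  have rep: "\<exists>j<n. \<exists>i. z = ?l j i" for z
    by (rule coprime_multiple_cong_exists[OF assms(1,2), of z]) (use cong_multiple_diff in blast)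
  have "z \<in> label n p ` north_starts x \<longleftrightarrow> z \<notin> G \<and> z - int n \<in> G" for z
  proof -
    obtain j i where ji: "j < n" "z = ?l j i" using rep by blast
    have "z - int n = ?l j (i + 1)" using ji by (simp add: algebra_simps)
    then have "z \<in> G \<longleftrightarrow> int (a j) < i" "z - int n \<in> G \<longleftrightarrow> int (a j) < i + 1"
      using G[OF ji(1)] ji(2) by metis+
    then have "z \<notin> G \<and> z - int n \<in> G \<longleftrightarrow> i = int (a j)" by linarith
    also have "\<dots> \<longleftrightarrow> z \<in> label n p ` north_starts x"
    proof
      assume "i = int (a j)"
      then show "z \<in> label n p ` north_starts x"
        unfolding a image_image label_def using ji by force
    next
      assume "z \<in> label n p ` north_starts x"
      then obtain j' where "j' < n" "z = ?l j' (int (a j'))" by (auto simp: a label_def)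
      then show "i = int (a j)" using l_eq ji by metis
    qed
    finally show ?thesis by blast
  qed
  then show ?thesis by blast
qed

text \<open>The positive labels below a path determine its North labels by
  \<open>north_labels_eq\<close>, these determine the North starts, and the North starts determine
  the path.\<close>

lemma dyck_path_eqI:
  assumes "0 < n" "coprime n p" "x \<in> dyck_paths n p" "y \<in> dyck_paths n p"
    and "pos_labels_below n p x = pos_labels_below n p y"
  shows "x = y"
proof (rule path_eqI)
  show "end_point x = end_point y"
    using assms(3,4) by (simp add: dyck_paths_def end_point_def)
  \<comment> \<open>The restriction on the height matters, since \<open>(i, j)\<close> and
    \<open>(i + p, j + n)\<close> have equal labels.\<close>
  have "inj_on (label n p) (UNIV \<times> {..<n})"
  proof (rule inj_onI)
    fix u v
    assume "u \<in> UNIV \<times> {..<n}" "v \<in> UNIV \<times> {..<n}" and uv: "label n p u = label n p v"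
    then obtain i j i' j' where ij: "u = (i, j)" "v = (i', j')" "j < n" "j' < n"
      by blast
    have eq: "label n p (i, j) = label n p (i', j')" using uv ij by simp
    have "int j * int p = (int i - int i') * int n + int j' * int p"
      using eq by (simp add: label_def algebra_simps)
    then have "[int j * int p = int j' * int p] (mod int n)" by (simp add: cong_def)
    then have "j = j'"
      using coprime_multiples_cong_iff assms(2) ij(3,4) by blast
    then show "u = v" using eq assms(1) ij by (simp add: label_def)
  qed
  moreover have "label n p ` north_starts x = label n p ` north_starts y"
    using assms by (simp add: north_labels_eq)
  moreover have "north_starts x \<subseteq> UNIV \<times> {..<n}" "north_starts y \<subseteq> UNIV \<times> {..<n}"
    using north_starts_bound assms(3,4) by (fastforce simp: dyck_paths_def)+
  ultimately show "north_starts x = north_starts y"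
    by (simp add: inj_on_image_eq_iff)
qed

text \<open>In row \<open>j\<close> the North step starts at the
  abscissa \<open>a\<close> for which \<open>j * p - a * n\<close> is the least element outside \<open>G\<close> of its class
  modulo \<open>n\<close>. Closure of \<open>G\<close> under subtraction of \<open>p\<close> makes these abscissas increase.\<close>

lemma dyck_path_exists:
  assumes "0 < n" "coprime n p"
    and neg: "{..<0} \<subseteq> G" and zero: "0 \<notin> G"
    and closed_n: "\<And>z. z \<in> G \<Longrightarrow> z - int n \<in> G" and closed_p: "\<And>z. z \<in> G \<Longrightarrow> z - int p \<in> G"
  obtains x where "x \<in> dyck_paths n p" "pos_labels_below n p x = {h \<in> G. 0 < h}"
proof -
  let ?l = "\<lambda>j i. int j * int p - int i * int n"
  define a where "a j = (LEAST i. ?l j (Suc i) \<in> G)" for j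
  \<comment> \<open>Far enough to the right the label is negative and hence in \<open>G\<close>, so
    the \<open>LEAST\<close> in \<open>a j\<close> exists.\<close>
  have "?l j (Suc (j * p)) \<in> G" for j
  proof -
    have "int (j * p) * 1 \<le> int (j * p) * int n"
      by (rule mult_left_mono) (use assms(1) in auto)
    then have "?l j (Suc (j * p)) < 0" using assms(1) by (simp add: algebra_simps)
    then show ?thesis using neg by blast
  qed
  then have in_G: "?l j (Suc (a j)) \<in> G" for j
    unfolding a_def by (rule LeastI)
  have closed_n': "z - int k * int n \<in> G" if "z \<in> G" for z k
  proof (induction k)
    case (Suc k)
    show ?case using closed_n[OF Suc] by (simp add: algebra_simps)
  qed (use that in simp)
  \<comment> \<open>Otherwise closure under subtraction of \<open>p\<close> would lead down to
    \<open>0\<close>.\<close>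
  have not_G_p: "int j * int p \<notin> G" for j
  proof (induction j)
    case (Suc j)
    show ?case using closed_p[of "int (Suc j) * int p"] Suc by (auto simp: algebra_simps)
  qed (use zero in simp)
  have not_in_G: "?l j (a j) \<notin> G" for j
  proof (cases "a j")
    case 0
    then show ?thesis using not_G_p by simp
  next
    case (Suc k)
    then have "k < (LEAST i. ?l j (Suc i) \<in> G)" by (simp add: a_def)
    from not_less_Least[OF this] show ?thesis using Suc by simp
  qed
  have G: "?l j i \<in> G \<longleftrightarrow> a j < i" for i j
  proof
    assume "?l j i \<in> G"
    show "a j < i"
    proof (rule ccontr)
      assume "\<not> a j < i"
      then have "?l j i - int (a j - i) * int n = ?l j (a j)"
        by (simp add: of_nat_diff algebra_simps)
      then show False using closed_n'[OF \<open>?l j i \<in> G\<close>] not_in_G by metis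
    qed
  next
    assume "a j < i"
    then have "?l j (Suc (a j)) - int (i - Suc (a j)) * int n = ?l j i"
      by (simp add: of_nat_diff algebra_simps)
    then show "?l j i \<in> G" using closed_n'[OF in_G] by metis
  qed
  have le: "n * a j \<le> p * j" for j
  proof -
    have "0 \<le> ?l j (a j)" using not_in_G[of j] neg by (meson lessThan_iff not_less subsetD)
    then have "int (n * a j) \<le> int (p * j)" by (simp add: mult.commute)
    then show ?thesis by linarith
  qed
  have "a 0 = 0" using le[of 0] assms(1) by simp
  moreover have "mono a"
  proof (rule mono_iff_le_Suc[THEN iffD2], intro allI)
    fix j
    have "?l (Suc j) (a j) - int p \<notin> G" using not_in_G[of j] by (simp add: algebra_simps)
    then have "?l (Suc j) (a j) \<notin> G" using closed_p by blast
    then show "a j \<le> a (Suc j)" using G[of "Suc j" "a j"] by linarith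
  qed
  moreover have "a n = p"
  proof -
    \<comment> \<open>The corner \<open>(p, n)\<close> has label 0, a non-element of
      \<open>G\<close>, which bounds \<open>a n\<close> from below; the diagonal bounds it from
      above.\<close>
    have "?l n p \<notin> G" using zero by (simp add: mult.commute)
    then have "p \<le> a n" using G[of n p] by linarith
    moreover have "a n \<le> p" using le[of n] assms(1) by (simp add: mult.commute)
    ultimately show ?thesis by simp
  qed
  ultimately have x: "staircase a n \<in> dyck_paths n p"
    and ns: "north_starts (staircase a n) = (\<lambda>j. (a j, j)) ` {..<n}"
    using staircase_in_dyck_paths le north_starts_staircase by blast+
  have "h \<in> pos_labels_below n p (staircase a n) \<longleftrightarrow> h \<in> G \<and> 0 < h" for h
  proof
    assume "h \<in> pos_labels_below n p (staircase a n)"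
    then show "h \<in> G \<and> 0 < h" using G by (auto simp: pos_labels_below_iff[OF ns])
  next
    assume h: "h \<in> G \<and> 0 < h"
    obtain j i where ji: "j < n" "h = int j * int p - i * int n"
      by (rule coprime_multiple_cong_exists[OF assms(1,2), of h]) (use cong_multiple_diff in blast)
    \<comment> \<open>A negative abscissa would put \<open>h\<close> above \<open>j * p\<close> in
      its class, and descending by \<open>n\<close> would bring \<open>j * p\<close> into
      \<open>G\<close>.\<close>
    have "0 \<le> i"
    proof (rule ccontr)
      assume "\<not> 0 \<le> i"
      then have "h - int (nat (- i)) * int n = int j * int p" using ji by simp
      then show False using closed_n'[of h "nat (- i)"] h not_G_p by metis
    qed
    then have "h = ?l j (nat i)" using ji by simp
    then show "h \<in> pos_labels_below n p (staircase a n)"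
      unfolding pos_labels_below_iff[OF ns] using G h ji(1) by metis
  qed
  with x that show ?thesis by blast
qed

section \<open>Partitions and their abaci\<close>

lemma cells_first_column:
  assumes "\<kappa> \<in> partitions"
  shows "(i, 1) \<in> cells \<kappa> \<longleftrightarrow> 1 \<le> i \<and> i \<le> length \<kappa>"
proof -
  have "1 \<le> part \<kappa> i" if "1 \<le> i" "i \<le> length \<kappa>"
  proof -
    have "\<kappa> ! (i - 1) \<in> set \<kappa>" using that by (intro nth_mem) linarith
    moreover have "0 \<notin> set \<kappa>" using assms by (simp add: partitions_def)
    ultimately have "\<kappa> ! (i - 1) \<noteq> 0" by metis
    then show ?thesis using that by (simp add: part_def)
  qed
  then show ?thesis by (auto simp: cells_def)
qed

text \<open>The row with \<open>k\<close> rows after it has first-column hook length its part plus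
  \<open>k\<close>. Reversing the partition makes \<open>k\<close> a list index.\<close>

lemma first_column_hooks_eq:
  assumes "\<kappa> \<in> partitions"
  shows "first_column_hooks \<kappa> = (\<lambda>k. rev \<kappa> ! k + k) ` {..<length \<kappa>}"
proof -
  have conj: "conj_part \<kappa> 1 = length \<kappa>"
  proof -
    have "{i. (i, 1) \<in> cells \<kappa>} = {1..length \<kappa>}"
      unfolding cells_first_column[OF assms] by auto
    then show ?thesis by (simp add: conj_part_def)
  qed
  have hook: "hook_length \<kappa> (i, 1) = rev \<kappa> ! (length \<kappa> - i) + (length \<kappa> - i)"
    if "1 \<le> i" "i \<le> length \<kappa>" for i
  proof -
    have "1 \<le> part \<kappa> i" using cells_first_column[OF assms, of i] that by (simp add: cells_def)
    moreover have "rev \<kappa> ! (length \<kappa> - i) = part \<kappa> i"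
      using that by (simp add: rev_nth part_def Suc_diff_le)
    ultimately show ?thesis by (simp add: hook_length_def conj[unfolded One_nat_def])
  qed
  show ?thesis
  proof (intro set_eqI iffI)
    fix h
    assume "h \<in> first_column_hooks \<kappa>"
    then obtain i where i: "h = hook_length \<kappa> (i, 1)" "1 \<le> i" "i \<le> length \<kappa>"
      unfolding first_column_hooks_def cells_first_column[OF assms] by blast
    then show "h \<in> (\<lambda>k. rev \<kappa> ! k + k) ` {..<length \<kappa>}"
      by (intro image_eqI[of _ _ "length \<kappa> - i"]) (use hook in auto)
  next
    fix h
    assume "h \<in> (\<lambda>k. rev \<kappa> ! k + k) ` {..<length \<kappa>}"
    then obtain k where k: "h = rev \<kappa> ! k + k" "k < length \<kappa>" by auto
    then have "h = hook_length \<kappa> (length \<kappa> - k, 1)" by (subst hook) auto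
    moreover have "(length \<kappa> - k, 1) \<in> cells \<kappa>"
      unfolding cells_first_column[OF assms] using k by simp
    ultimately show "h \<in> first_column_hooks \<kappa>" unfolding first_column_hooks_def by blast
  qed
qed

lemma partitions_sorted_rev: "\<kappa> \<in> partitions \<Longrightarrow> sorted (rev \<kappa>)"
  by (simp add: partitions_def sorted_wrt_rev)

text \<open>The reversed parts increase weakly and the index strictly, so the hooks come out in
  strict order. The length and the parts can thus be recovered from the hook set.\<close>

lemma sorted_list_of_first_column_hooks:
  assumes "\<kappa> \<in> partitions"
  shows "sorted_list_of_set (first_column_hooks \<kappa>) = map (\<lambda>k. rev \<kappa> ! k + k) [0..<length \<kappa>]"
proof -
  have "rev \<kappa> ! i + i < rev \<kappa> ! j + j" if "i < j" "j < length \<kappa>" for i j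
    using sorted_nth_mono[OF partitions_sorted_rev[OF assms], of i j] that by simp
  then have "sorted_wrt (<) (map (\<lambda>k. rev \<kappa> ! k + k) [0..<length \<kappa>])"
    by (simp add: sorted_wrt_iff_nth_less)
  then have "sorted_list_of_set (set (map (\<lambda>k. rev \<kappa> ! k + k) [0..<length \<kappa>])) =
      map (\<lambda>k. rev \<kappa> ! k + k) [0..<length \<kappa>]"
    by (simp only: strict_sorted_iff sorted_list_of_set.idem_if_sorted_distinct)
  then show ?thesis by (simp add: first_column_hooks_eq[OF assms] atLeast0LessThan)
qed

lemma card_first_column_hooks:
  "\<kappa> \<in> partitions \<Longrightarrow> card (first_column_hooks \<kappa>) = length \<kappa>"
  using arg_cong[OF sorted_list_of_first_column_hooks, of \<kappa> length] by simp

lemma first_column_hooks_inject: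
  assumes "\<kappa> \<in> partitions" "\<mu> \<in> partitions" "first_column_hooks \<kappa> = first_column_hooks \<mu>"
  shows "\<kappa> = \<mu>"
proof -
  have len: "length \<kappa> = length \<mu>" using assms by (metis card_first_column_hooks)
  have "map (\<lambda>k. rev \<kappa> ! k + k) [0..<length \<kappa>] = map (\<lambda>k. rev \<mu> ! k + k) [0..<length \<mu>]"
    using assms by (metis sorted_list_of_first_column_hooks)
  then have "rev \<kappa> ! k = rev \<mu> ! k" if "k < length \<kappa>" for k
    using that len by simp
  then have "rev \<kappa> = rev \<mu>" using len by (intro nth_equalityI) auto
  then show ?thesis by simp
qed

lemma first_column_hooks_pos: "h \<in> first_column_hooks \<kappa> \<Longrightarrow> 0 < h"
  by (auto simp: first_column_hooks_def hook_length_def)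

text \<open>Subtracting its index from each element of the sorted list inverts
  \<open>first_column_hooks_eq\<close>. Strict growth makes the differences weakly increasing, and
  \<open>0 \<notin> H\<close> makes them positive.\<close>

lemma partition_with_first_column_hooks:
  assumes "finite H" "0 \<notin> H"
  obtains \<kappa> where "\<kappa> \<in> partitions" "first_column_hooks \<kappa> = H"
proof -
  define hs where "hs = sorted_list_of_set H"
  have hs: "sorted hs" "distinct hs" "set hs = H" using assms(1) by (auto simp: hs_def)
  then have strict: "sorted_wrt (<) hs" by (simp add: strict_sorted_iff)
  have less: "hs ! i < hs ! j" if "i < j" "j < length hs" for i j
    using sorted_wrt_nth_less[OF strict that] .
  have gt: "k < hs ! k" if "k < length hs" for k
    using that
  proof (induction k)
    case 0
    then have "hs ! 0 \<in> H" using hs(3) nth_mem by blast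
    then show ?case using assms(2) by (cases "hs ! 0") auto
  next
    case (Suc k)
    then show ?case using less[of k "Suc k"] by simp
  qed
  have step: "hs ! i - i \<le> hs ! j - j" if "i \<le> j" "j < length hs" for i j
    using that
  proof (induction j rule: dec_induct)
    case (step j)
    then show ?case using less[of j "Suc j"] by simp
  qed simp
  define \<kappa> where "\<kappa> = rev (map (\<lambda>k. hs ! k - k) [0..<length hs])"
  have "sorted (map (\<lambda>k. hs ! k - k) [0..<length hs])"
    using step by (simp add: sorted_iff_nth_mono)
  then have part: "\<kappa> \<in> partitions"
    using gt by (fastforce simp: partitions_def \<kappa>_def sorted_wrt_rev)
  have "first_column_hooks \<kappa> = (\<lambda>k. hs ! k) ` {..<length hs}"
    unfolding first_column_hooks_eq[OF part]
    using gt by (intro image_cong) (auto simp: \<kappa>_def less_imp_le)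
  also have "\<dots> = H" using hs(3) by (simp add: set_conv_nth image_def) blast
  finally show ?thesis using part that by blast
qed

text \<open>Row \<open>i\<close> has bead \<open>part \<kappa> i + 1 - i\<close> and hook length
  \<open>part \<kappa> i + length \<kappa> - i\<close>, which differ by
  \<open>length \<kappa> - 1\<close>. The zero parts past the end supply the negative
  integers.\<close>

lemma partition_abacus_iff:
  assumes "\<kappa> \<in> partitions"
  shows "z \<in> partition_abacus \<kappa> \<longleftrightarrow>
    z + int (length \<kappa>) - 1 \<in> int ` first_column_hooks \<kappa> \<union> {..<0}"
proof
  assume "z \<in> partition_abacus \<kappa>"
  then obtain i where i: "1 \<le> i" "z = int (part \<kappa> i) + 1 - int i"
    by (auto simp: partition_abacus_def)
  show "z + int (length \<kappa>) - 1 \<in> int ` first_column_hooks \<kappa> \<union> {..<0}"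
  proof (cases "i \<le> length \<kappa>")
    case True
    have "rev \<kappa> ! (length \<kappa> - i) = part \<kappa> i"
      using True i by (simp add: rev_nth part_def Suc_diff_le)
    then have "z + int (length \<kappa>) - 1 = int (rev \<kappa> ! (length \<kappa> - i) + (length \<kappa> - i))"
      using True i by (simp add: of_nat_diff)
    moreover have "length \<kappa> - i < length \<kappa>" using True i by linarith
    ultimately show ?thesis unfolding first_column_hooks_eq[OF assms] by blast
  next
    case False
    then show ?thesis using i by (simp add: part_def)
  qed
next
  assume "z + int (length \<kappa>) - 1 \<in> int ` first_column_hooks \<kappa> \<union> {..<0}"
  then consider k where "k < length \<kappa>" "z + int (length \<kappa>) - 1 = int (rev \<kappa> ! k + k)"
    | "z + int (length \<kappa>) - 1 < 0"
    by (auto simp: first_column_hooks_eq[OF assms])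
  then show "z \<in> partition_abacus \<kappa>"
  proof cases
    case 1
    then have "z = int (part \<kappa> (length \<kappa> - k)) + 1 - int (length \<kappa> - k)" "1 \<le> length \<kappa> - k"
      by (auto simp: part_def rev_nth of_nat_diff)
    then show ?thesis unfolding partition_abacus_def by blast
  next
    case 2
    then have "z = int (part \<kappa> (nat (1 - z))) + 1 - int (nat (1 - z))" "1 \<le> nat (1 - z)"
      by (auto simp: part_def)
    then show ?thesis unfolding partition_abacus_def by blast
  qed
qed

lemma partition_abacus_inject:
  assumes "\<kappa> \<in> partitions" "\<mu> \<in> partitions" "partition_abacus \<kappa> = partition_abacus \<mu>"
  shows "\<kappa> = \<mu>"
proof -
  \<comment> \<open>The least gap of the abacus reveals the length; after that shift the positive
    beads are the hooks.\<close>
  have gap: "1 - int (length \<nu>) \<notin> partition_abacus \<nu>"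
    "z < 1 - int (length \<nu>) \<Longrightarrow> z \<in> partition_abacus \<nu>" if "\<nu> \<in> partitions" for \<nu> z
    unfolding partition_abacus_iff[OF that] using first_column_hooks_pos[of 0 \<nu>] by auto
  have len: "length \<kappa> = length \<mu>"
    using gap[OF assms(1)] gap[OF assms(2)] assms(3)
    by (cases "length \<kappa>" "length \<mu>" rule: linorder_cases) auto
  have "h \<in> first_column_hooks \<nu> \<longleftrightarrow> 0 < h \<and> int h + 1 - int (length \<nu>) \<in> partition_abacus \<nu>"
    if "\<nu> \<in> partitions" for \<nu> h
    unfolding partition_abacus_iff[OF that] using first_column_hooks_pos[of h \<nu>] by auto
  then have "first_column_hooks \<kappa> = first_column_hooks \<mu>"
    using assms len by (simp add: set_eq_iff)
  then show ?thesis using assms first_column_hooks_inject by blast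
qed

section \<open>Hook lengths as distances between beads and gaps\<close>

lemma le_part_iff_le_conj_part:
  assumes "\<kappa> \<in> partitions" "1 \<le> i" "1 \<le> j"
  shows "j \<le> part \<kappa> i \<longleftrightarrow> i \<le> conj_part \<kappa> j"
proof -
  have anti: "part \<kappa> i' \<le> part \<kappa> i" if "1 \<le> i" "i \<le> i'" for i i'
  proof (cases "i = i' \<or> length \<kappa> < i'")
    case False
    then have "\<kappa> ! (i' - 1) \<le> \<kappa> ! (i - 1)"
      using that assms(1) by (auto simp: partitions_def intro: sorted_wrt_nth_less[where P = "(\<ge>)"])
    then show ?thesis using False that by (simp add: part_def)
  qed (auto simp: part_def)
  define S where "S = {i. (i, j) \<in> cells \<kappa>}"
  have S: "i \<in> S \<longleftrightarrow> 1 \<le> i \<and> j \<le> part \<kappa> i" for i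
    using assms(3) by (auto simp: S_def cells_def part_def)
  have fin: "finite S" by (rule finite_subset[of _ "{..length \<kappa>}"]) (auto simp: S_def cells_def)
  show ?thesis
  proof
    assume "j \<le> part \<kappa> i"
    \<comment> \<open>Parts decrease weakly, so column \<open>j\<close> occupies an initial segment
      of the rows and comparing \<open>i\<close> with its size decides membership.\<close>
    then have "{1..i} \<subseteq> S" using anti by (fastforce simp: S)
    then have "card {1..i} \<le> card S" using fin card_mono by blast
    then show "i \<le> conj_part \<kappa> j" by (simp add: conj_part_def S_def)
  next
    assume *: "i \<le> conj_part \<kappa> j"
    show "j \<le> part \<kappa> i"
    proof (rule ccontr)
      assume "\<not> j \<le> part \<kappa> i"
      then have "S \<subseteq> {1..<i}" using anti[OF assms(2)] by (force simp: S not_le)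
      then have "card S \<le> i - 1" using card_mono[of "{1..<i}" S] by simp
      then show False using * assms(2) by (simp add: conj_part_def S_def)
    qed
  qed
qed

text \<open>The hook at \<open>(i, j)\<close> spans from the bead of row \<open>i\<close> down to
  \<open>j - conj_part \<kappa> j\<close>. This number is a gap: rows meeting column
  \<open>j\<close> have larger beads, all other rows smaller ones. An abacus closed under
  subtracting \<open>n\<close> hence admits no hook of length \<open>n\<close>.\<close>

lemma hook_length_abacus:
  assumes "\<kappa> \<in> partitions" "c \<in> cells \<kappa>"
  obtains z where "z \<in> partition_abacus \<kappa>" "z - int (hook_length \<kappa> c) \<notin> partition_abacus \<kappa>"
proof -
  obtain i j where c: "c = (i, j)" "1 \<le> i" "1 \<le> j" "j \<le> part \<kappa> i"
    using assms(2) by (auto simp: cells_def)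
  note iff = le_part_iff_le_conj_part[OF assms(1) _ c(3)]
  have "i \<le> conj_part \<kappa> j" using iff c by blast
  then have diff: "int (part \<kappa> i) + 1 - int i - int (hook_length \<kappa> c) = int j - int (conj_part \<kappa> j)"
    using c by (simp add: hook_length_def of_nat_diff)
  have "int j - int (conj_part \<kappa> j) \<noteq> int (part \<kappa> i') + 1 - int i'" if "1 \<le> i'" for i'
    using iff[OF that] by (cases "i' \<le> conj_part \<kappa> j") auto
  then have "int j - int (conj_part \<kappa> j) \<notin> partition_abacus \<kappa>"
    by (auto simp: partition_abacus_def)
  moreover have "int (part \<kappa> i) + 1 - int i \<in> partition_abacus \<kappa>"
    using c by (auto simp: partition_abacus_def)
  ultimately show ?thesis using that diff by metis
qed

lemma in_cores_if_abacus_closed: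
  assumes "\<kappa> \<in> partitions"
    and "\<And>z. z \<in> partition_abacus \<kappa> \<Longrightarrow> z - int n \<in> partition_abacus \<kappa>"
    and "\<And>z. z \<in> partition_abacus \<kappa> \<Longrightarrow> z - int p \<in> partition_abacus \<kappa>"
  shows "\<kappa> \<in> cores n p"
proof -
  have "hook_length \<kappa> c \<noteq> n \<and> hook_length \<kappa> c \<noteq> p" if "c \<in> cells \<kappa>" for c
    by (rule hook_length_abacus[OF assms(1) that]) (use assms(2,3) in blast)
  then show ?thesis using assms(1) by (simp add: cores_def)
qed

section \<open>Dominant affine permutations\<close>

lemma window_unique:
  fixes i i' :: int
  assumes "i \<in> {1..int n}" "i' \<in> {1..int n}" "i + k * int n = i' + k' * int n"
  shows "i = i' \<and> k = k'"
proof -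
  have n: "0 < int n" using assms(1) by auto
  have "(k' - k) * int n = i - i'" using assms(3) by (simp add: algebra_simps)
  then have "(k' - k) * int n < 1 * int n" "- 1 * int n < (k' - k) * int n"
    using assms(1,2) by auto
  then have "k' - k < 1" "- 1 < k' - k"
    using mult_less_cancel_right_pos[OF n] by blast+
  then have "k = k'" by linarith
  then show ?thesis using assms(3) by simp
qed

lemma shift_equivariant_multiple:
  fixes f :: "int \<Rightarrow> int"
  assumes "\<And>i. f (i + int n) = f i + int n"
  shows "f (i + k * int n) = f i + k * int n"
proof -
  have nat: "f (i + int k * int n) = f i + int k * int n" for i k
  proof (induction k)
    case (Suc k)
    have "i + int (Suc k) * int n = i + int k * int n + int n" by (simp add: algebra_simps)
    then show ?case using assms[of "i + int k * int n"] Suc by (simp add: algebra_simps)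
  qed simp
  show ?thesis
  proof (cases "0 \<le> k")
    case True
    then show ?thesis using nat[of i "nat k"] by simp
  next
    case False
    then show ?thesis using nat[of "i + k * int n" "nat (- k)"] by simp
  qed
qed

text \<open>If \<open>f i\<close> and \<open>f j\<close> are congruent, then
  \<open>f i = f (j + k * n)\<close> for some \<open>k\<close>, and injectivity gives
  \<open>i = j\<close> within the window. Counting yields surjectivity.\<close>

lemma shift_equivariant_residues:
  fixes f :: "int \<Rightarrow> int"
  assumes "0 < n" "inj f" "\<And>i. f (i + int n) = f i + int n"
  shows "bij_betw (\<lambda>i. (f i - c) mod int n) {1..int n} {0..<int n}"
proof -
  have inj: "inj_on (\<lambda>i. (f i - c) mod int n) {1..int n}"
  proof (rule inj_onI)
    fix i j
    assume ij: "i \<in> {1..int n}" "j \<in> {1..int n}" "(f i - c) mod int n = (f j - c) mod int n"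
    then have "int n dvd (f i - c) - (f j - c)" by (simp only: mod_eq_dvd_iff)
    then obtain k where "f i - f j = int n * k" by auto
    then have "f i = f (j + k * int n)"
      using shift_equivariant_multiple[of f n j k] assms(3) by (simp add: algebra_simps)
    then have "i + 0 * int n = j + k * int n" using assms(2) by (simp add: inj_eq)
    then show "i = j" using window_unique[OF ij(1,2), of 0 k] by simp
  qed
  have "(\<lambda>i. (f i - c) mod int n) ` {1..int n} = {0..<int n}"
  proof (rule card_subset_eq)
    show "(\<lambda>i. (f i - c) mod int n) ` {1..int n} \<subseteq> {0..<int n}" using assms(1) by auto
    show "card ((\<lambda>i. (f i - c) mod int n) ` {1..int n}) = card {0..<int n}"
      using inj by (simp add: card_image)
  qed simp
  then show ?thesis using inj by (simp add: bij_betw_def)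
qed

lemma sum_int_atLeastAtMost: "(\<Sum>i\<in>{1..int n}. i) = int (n * (n + 1) div 2)"
proof -
  have "(\<Sum>i\<in>{1..int n}. i) = (\<Sum>i\<in>int ` {1..n}. i)" by (simp add: image_int_atLeastAtMost)
  also have "\<dots> = int (\<Sum>{1..n})" by (simp add: sum.reindex)
  also have "\<Sum>{1..n} = n * (n + 1) div 2" using gauss_sum_from_Suc_0[of n, where 'a = nat] by simp
  finally show ?thesis .
qed

section \<open>Affine permutations and their inverses\<close>

locale affine_permutation =
  fixes n :: nat and \<omega> :: "int \<Rightarrow> int"
  assumes n_pos: "0 < n" and affine: "\<omega> \<in> affine_permutations n"
begin

abbreviation "w \<equiv> inv \<omega>"

lemma bij: "bij \<omega>" and shift1: "\<omega> (i + int n) = \<omega> i + int n"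
  and sum_eq: "(\<Sum>i\<in>{1..int n}. \<omega> i) = (\<Sum>i\<in>{1..int n}. i)"
  using affine unfolding affine_permutations_def sum_int_atLeastAtMost by auto

lemma \<omega>_w [simp]: "\<omega> (w i) = i" and w_\<omega> [simp]: "w (\<omega> i) = i"
  using bij by (auto simp: bij_is_surj surj_f_inv_f bij_is_inj)

lemma w_inj [simp]: "w i = w j \<longleftrightarrow> i = j"
  by (metis \<omega>_w)

lemma shift: "\<omega> (i + k * int n) = \<omega> i + k * int n"
  using shift_equivariant_multiple shift1 by blast

lemma w_shift: "w (i + k * int n) = w i + k * int n"
  by (metis \<omega>_w shift w_\<omega>)

lemma w_shift1: "w (i + int n) = w i + int n"
  using w_shift[of i 1] by simp

lemma window_decomp:
  obtains i k where "i \<in> {1..int n}" "y = i + k * int n"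
proof -
  have "y = ((y - 1) mod int n + 1) + (y - 1) div int n * int n"
    using div_mult_mod_eq[of "y - 1" "int n"] by linarith
  moreover have "(y - 1) mod int n + 1 \<in> {1..int n}"
    using n_pos pos_mod_bound[of "int n" "y - 1"] by (simp add: add1_zle_eq del: pos_mod_bound)
  ultimately show ?thesis using that by blast
qed

lemma window_nonpos_iff: "i \<in> {1..int n} \<Longrightarrow> i + k * int n \<le> 0 \<longleftrightarrow> k < 0"
proof -
  assume i: "i \<in> {1..int n}"
  have "k * int n \<le> - 1 * int n" if "k < 0"
    using that by (intro mult_right_mono) auto
  moreover have "0 \<le> k * int n" if "\<not> k < 0" using that by simp
  moreover have "1 \<le> i" "i \<le> int n" using i by auto
  ultimately show ?thesis by (cases "k < 0"; linarith)
qed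

text \<open>Reduce \<open>\<omega> i\<close> to \<open>v i\<close> in the window. Then
  \<open>v\<close> permutes the window and \<open>w (v i) = i + v i - \<omega> i\<close>; on
  summation the last two terms cancel by the normalisation of \<open>\<omega>\<close>.\<close>

lemma sum_w_eq: "(\<Sum>i\<in>{1..int n}. w i) = (\<Sum>i\<in>{1..int n}. i)"
proof -
  define v where "v i = (\<omega> i - 1) mod int n + 1" for i
  define q where "q i = (\<omega> i - 1) div int n" for i
  have dec: "\<omega> i = v i + q i * int n" for i
    using div_mult_mod_eq[of "\<omega> i - 1" "int n"] by (simp add: v_def q_def)
  have "bij_betw ((\<lambda>i. i + 1) \<circ> (\<lambda>i. (\<omega> i - 1) mod int n)) {1..int n} {1..int n}"
  proof (rule bij_betw_trans)
    show "bij_betw (\<lambda>i. (\<omega> i - 1) mod int n) {1..int n} {0..<int n}"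
      using shift_equivariant_residues n_pos bij bij_is_inj shift1 by blast
    show "bij_betw (\<lambda>i. i + 1) {0..<int n} {1..int n}"
      by (rule bij_betw_byWitness[where f' = "\<lambda>i. i - 1"]) auto
  qed
  then have v: "bij_betw v {1..int n} {1..int n}" by (simp add: v_def[abs_def] comp_def)
  have "w (v i) = i - q i * int n" for i
  proof -
    have "w (\<omega> i + - q i * int n) = i - q i * int n" unfolding w_shift by simp
    moreover have "\<omega> i + - q i * int n = v i" using dec[of i] by simp
    ultimately show ?thesis by metis
  qed
  then have "(\<Sum>i\<in>{1..int n}. w i) = (\<Sum>i\<in>{1..int n}. i - q i * int n)"
    using sum.reindex_bij_betw[OF v, of w] by simp
  also have "\<dots> = (\<Sum>i\<in>{1..int n}. i + v i - \<omega> i)"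
    by (rule sum.cong) (auto simp: dec)
  also have "\<dots> = (\<Sum>i\<in>{1..int n}. i)"
    using sum.reindex_bij_betw[OF v, of id] sum_eq by (simp add: sum.distrib sum_subtractf)
  finally show ?thesis .
qed

lemma residue_perm:
  "residue_perm n \<omega> permutes {1..n} \<and>
   (\<forall>i\<in>{1..n}. [int (residue_perm n \<omega> i) = w (int i)] (mod int n))"
  unfolding residue_perm_def
proof (rule theI'[where P = "\<lambda>s. s permutes {1..n} \<and> (\<forall>i\<in>{1..n}. [int (s i) = w (int i)] (mod int n))"])
  \<comment> \<open>Shifting by 1 before and after the reduction picks representatives in
    \<open>1..n\<close> instead of \<open>0..n-1\<close>; outside the window \<open>permutes\<close>
    requires the identity.\<close>
  define s where "s i = (if i \<in> {1..n} then nat ((w (int i) - 1) mod int n + 1) else i)" for i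
  have in_range: "(w (int i) - 1) mod int n + 1 \<in> {1..int n}" for i
    using n_pos pos_mod_bound[of "int n" "w (int i) - 1"] by (simp add: add1_zle_eq del: pos_mod_bound)
  have int_s: "int (s i) = (w (int i) - 1) mod int n + 1" if "i \<in> {1..n}" for i
    using that in_range[of i] by (simp add: s_def)
  have cong: "[int (s i) = w (int i)] (mod int n)" if "i \<in> {1..n}" for i
    unfolding int_s[OF that] by (simp add: cong_def mod_add_left_eq)
  have "inj_on s {1..n}"
  proof (rule inj_onI)
    fix i j
    assume ij: "i \<in> {1..n}" "j \<in> {1..n}" "s i = s j"
    then have "(w (int i) - 1) mod int n = (w (int j) - 1) mod int n"
      using int_s by (metis add_right_cancel)
    moreover have "inj_on (\<lambda>i. (w i - 1) mod int n) {1..int n}"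
      using shift_equivariant_residues[OF n_pos, of w 1] w_shift1
      by (auto simp: bij_betw_def inj_def)
    ultimately show "i = j" using ij(1,2) by (auto dest: inj_onD)
  qed
  moreover have "s ` {1..n} \<subseteq> {1..n}"
  proof
    fix k
    assume "k \<in> s ` {1..n}"
    then obtain i where "i \<in> {1..n}" "k = s i" by blast
    then have "int k \<in> {1..int n}" using int_s[of i] in_range[of i] by metis
    then show "k \<in> {1..n}" by simp
  qed
  ultimately have "bij_betw s {1..n} {1..n}"
    by (simp add: bij_betw_def endo_inj_surj)
  then have perm: "s permutes {1..n}" by (rule bij_imp_permutes) (simp only: s_def if_False)
  show "\<exists>!s. s permutes {1..n} \<and> (\<forall>i\<in>{1..n}. [int (s i) = w (int i)] (mod int n))"
  proof (rule ex1I[of _ s])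
    show "s permutes {1..n} \<and> (\<forall>i\<in>{1..n}. [int (s i) = w (int i)] (mod int n))"
      using perm cong by blast
    fix t
    assume t: "t permutes {1..n} \<and> (\<forall>i\<in>{1..n}. [int (t i) = w (int i)] (mod int n))"
    show "t = s"
    proof
      fix i
      show "t i = s i"
      proof (cases "i \<in> {1..n}")
        case True
        then have "[int (t i) = int (s i)] (mod int n)"
          by (rule cong_trans[OF bspec[OF conjunct2[OF t]] cong_sym[OF cong[OF True]]])
        then have "int n dvd int (t i) - int (s i)" by (simp add: cong_iff_dvd_diff)
        then obtain k where "int (t i) - int (s i) = int n * k" by (rule dvdE)
        then have "int (t i) + 0 * int n = int (s i) + k * int n" by (simp add: algebra_simps)
        moreover have "t i \<in> {1..n}" "s i \<in> {1..n}"
          using True permutes_in_image[OF conjunct1[OF t], of i] permutes_in_image[OF perm, of i]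
          by simp_all
        ultimately show ?thesis using window_unique[of "int (t i)" n "int (s i)" 0 k] by auto
      next
        case False
        then show ?thesis
          by (metis permutes_not_in[OF conjunct1[OF t]] permutes_not_in[OF perm])
      qed
    qed
  qed
qed

end

section \<open>The normalised abacus of a dominant permutation\<close>

locale dominant_permutation = affine_permutation +
  assumes dominant: "dominant n \<omega>"
begin

text \<open>This is the abacus of \<open>\<omega>\<close> translated so that its least gap is
  \<open>0\<close>, as for first-column hooks.\<close>

definition G :: "int set" where
  "G = {h. \<omega> (h + w 1) \<le> 0}"

lemma w_less: "i \<in> {1..int n} \<Longrightarrow> j \<in> {1..int n} \<Longrightarrow> i < j \<Longrightarrow> w i < w j"
  using dominant by (auto simp: dominant_def strict_mono_on_def)

text \<open>Dominance gives the bound on the window, and positive \<open>y\<close> arise from the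
  window by adding nonnegative multiples of \<open>n\<close>.\<close>

lemma w_1_le: "1 \<le> y \<Longrightarrow> w 1 \<le> w y"
proof -
  assume y: "1 \<le> y"
  obtain i k where ik: "i \<in> {1..int n}" "y = i + k * int n" by (rule window_decomp)
  then have "0 \<le> k" using y window_nonpos_iff[of i k] by auto
  moreover have "w 1 \<le> w i" using w_less[of 1 i] ik(1) by (cases "i = 1") auto
  moreover have "0 \<le> k * int n" using \<open>0 \<le> k\<close> by simp
  ultimately show ?thesis unfolding ik(2) w_shift by linarith
qed

lemma G_neg: "{..<0} \<subseteq> G"
proof
  fix h :: int
  assume "h \<in> {..<0}"
  then show "h \<in> G" using w_1_le[of "\<omega> (h + w 1)"] by (force simp: G_def)
qed

lemma G_zero: "0 \<notin> G"
  by (simp add: G_def)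

lemma G_closed_n: "h \<in> G \<Longrightarrow> h - int n \<in> G"
  using shift[of "h + w 1" "- 1"] by (simp add: G_def algebra_simps)

lemma G_closed_p:
  assumes "p_stable p \<omega>" "h \<in> G"
  shows "h - int p \<in> G"
proof -
  have "\<omega> (h - int p + w 1) < \<omega> (h - int p + w 1 + int p)"
    using assms(1) unfolding p_stable_def by blast
  moreover have "h - int p + w 1 + int p = h + w 1" by simp
  ultimately show ?thesis using assms(2) unfolding G_def by simp
qed

text \<open>In the class of \<open>w i - w 1\<close> the elements of \<open>G\<close> are obtained
  by subtracting \<open>n\<close> at least once; positivity bounds the number \<open>k\<close> of
  subtractions by a quotient. This makes the positive part of \<open>G\<close> countable class by
  class.\<close>

lemma pos_G_bij:
  "bij_betw (\<lambda>(i, k). w i - w 1 - k * int n)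
     (SIGMA i:{1..int n}. {1..(w i - w 1) div int n}) {h \<in> G. 0 < h}"
proof (rule bij_betwI')
  fix u v
  assume "u \<in> (SIGMA i:{1..int n}. {1..(w i - w 1) div int n})"
    "v \<in> (SIGMA i:{1..int n}. {1..(w i - w 1) div int n})"
  then obtain i k i' k' where uv: "u = (i, k)" "v = (i', k')" "i \<in> {1..int n}" "i' \<in> {1..int n}"
    by auto
  have "u = v" if "w i - w 1 - k * int n = w i' - w 1 - k' * int n"
  proof -
    have "w (i + - k * int n) = w (i' + - k' * int n)" unfolding w_shift using that by simp
    then have "i + - k * int n = i' + - k' * int n" by (simp only: w_inj)
    then have "i = i' \<and> - k = - k'" by (rule window_unique[OF uv(3,4)])
    then show ?thesis using uv(1,2) by simp
  qed
  then show "((case u of (i, k) \<Rightarrow> w i - w 1 - k * int n) =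
      (case v of (i, k) \<Rightarrow> w i - w 1 - k * int n)) = (u = v)"
    using uv(1,2) by auto
next
  fix u
  assume "u \<in> (SIGMA i:{1..int n}. {1..(w i - w 1) div int n})"
  then obtain i k where ik: "u = (i, k)" "i \<in> {1..int n}" "1 \<le> k" "k \<le> (w i - w 1) div int n"
    by auto
  let ?h = "w i - w 1 - k * int n"
  have "?h + w 1 = w (i + - k * int n)" unfolding w_shift by simp
  then have \<omega>h: "\<omega> (?h + w 1) = i + - k * int n" by (simp only: \<omega>_w)
  then have in_G: "?h \<in> G" using ik window_nonpos_iff[of i "- k"] by (simp add: G_def)
  have "k * int n \<le> (w i - w 1) div int n * int n" using ik(4) by (intro mult_right_mono) auto
  also have "\<dots> \<le> w i - w 1" using n_pos div_mult_mod_eq[of "w i - w 1" "int n"]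
      pos_mod_sign[of "int n" "w i - w 1"] by linarith
  finally have "0 \<le> ?h" by simp
  \<comment> \<open>The bound on \<open>k\<close> yields only a nonnegative value; zero is excluded
    because it lies outside \<open>G\<close>.\<close>
  moreover have "?h \<noteq> 0" using in_G G_zero by metis
  ultimately show "(case u of (i, k) \<Rightarrow> w i - w 1 - k * int n) \<in> {h \<in> G. 0 < h}"
    using in_G ik(1) by simp
next
  fix h
  assume "h \<in> {h \<in> G. 0 < h}"
  then have h: "\<omega> (h + w 1) \<le> 0" "0 < h" by (auto simp: G_def)
  obtain i k where ik: "i \<in> {1..int n}" "\<omega> (h + w 1) = i + k * int n" by (rule window_decomp)
  have "w (\<omega> (h + w 1)) = w i + k * int n" unfolding ik(2) by (rule w_shift)
  then have h_eq: "h = w i - w 1 - - k * int n" by simp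
  have "k < 0" using h(1) ik window_nonpos_iff by simp
  moreover have "- k \<le> (w i - w 1) div int n"
  proof -
    have "- k * int n \<le> w i - w 1" using h_eq h(2) by linarith
    then have "- k * int n div int n \<le> (w i - w 1) div int n"
      using n_pos by (intro zdiv_mono1) auto
    moreover have "- k * int n div int n = - k"
      using n_pos by (intro nonzero_mult_div_cancel_right) auto
    ultimately show ?thesis by linarith
  qed
  ultimately have "(i, - k) \<in> (SIGMA i:{1..int n}. {1..(w i - w 1) div int n})"
    using ik(1) by auto
  then show "\<exists>u\<in>(SIGMA i:{1..int n}. {1..(w i - w 1) div int n}).
      h = (case u of (i, k) \<Rightarrow> w i - w 1 - k * int n)"
    using h_eq by (intro bexI[of _ "(i, - k)"]) auto
qed

lemma finite_pos_G: "finite {h \<in> G. 0 < h}"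
  using bij_betw_finite[OF pos_G_bij] by (simp add: finite_SigmaI)

text \<open>The normalisation of \<open>\<omega>(1) + \<dots> + \<omega>(n)\<close> says that the abacus has charge zero.\<close>

lemma card_pos_G: "int (card {h \<in> G. 0 < h}) = 1 - w 1"
proof -
  let ?D = "\<lambda>i. w i - w 1"
  have "card {h \<in> G. 0 < h} = card (SIGMA i:{1..int n}. {1..?D i div int n})"
    using bij_betw_same_card[OF pos_G_bij] by simp
  also have "int \<dots> = (\<Sum>i\<in>{1..int n}. int (nat (?D i div int n)))"
    by (simp add: card_SigmaI)
  also have "\<dots> = (\<Sum>i\<in>{1..int n}. ?D i div int n)"
  proof (rule sum.cong)
    fix i
    assume "i \<in> {1..int n}"
    then have "0 \<le> ?D i" using w_1_le by simp
    then show "int (nat (?D i div int n)) = ?D i div int n" by (simp add: div_int_pos_iff)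
  qed simp
  finally have "int (card {h \<in> G. 0 < h}) * int n = (\<Sum>i\<in>{1..int n}. ?D i div int n * int n)"
    by (simp add: sum_distrib_right)
  also have "\<dots> = (\<Sum>i\<in>{1..int n}. ?D i - ?D i mod int n)"
    by (simp add: minus_mod_eq_div_mult)
  also have "\<dots> = (\<Sum>i\<in>{1..int n}. w i) - int n * w 1 - (\<Sum>i\<in>{1..int n}. ?D i mod int n)"
    by (simp add: sum_subtractf)
  \<comment> \<open>The differences \<open>w i - w 1\<close> represent every residue class once, so
    their remainders have a known sum.\<close>
  also have "(\<Sum>i\<in>{1..int n}. ?D i mod int n) = (\<Sum>i\<in>{0..<int n}. i)"
    using sum.reindex_bij_betw[OF shift_equivariant_residues[OF n_pos, of w "w 1"], of id]
      w_shift1 by (simp add: inj_def)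
  also have "(\<Sum>i\<in>{1..int n}. w i) = (\<Sum>i\<in>{0..<int n}. i + 1)"
  proof -
    have "bij_betw (\<lambda>i. i + 1) {0..<int n} {1..int n}"
      by (rule bij_betw_byWitness[where f' = "\<lambda>i. i - 1"]) auto
    from sum.reindex_bij_betw[OF this, of id] show ?thesis using sum_w_eq by simp
  qed
  finally have "int (card {h \<in> G. 0 < h}) * int n = (1 - w 1) * int n"
    by (simp add: sum.distrib algebra_simps)
  then show ?thesis using n_pos by simp
qed

lemma pos_G_Un_neg: "{h \<in> G. 0 < h} \<union> {..<0} = G"
  using G_neg G_zero by (auto simp: not_less intro: le_neq_trans)

text \<open>Take the partition whose hooks are the positive part of \<open>G\<close>. Its abacus is
  a translate of \<open>G\<close>, and closure of \<open>G\<close> under subtracting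
  \<open>n\<close> and \<open>p\<close> makes it a core.\<close>

lemma core_exists:
  assumes "p_stable p \<omega>"
  obtains \<kappa> where "\<kappa> \<in> cores n p" "partition_abacus \<kappa> = affine_abacus \<omega>"
    "int ` first_column_hooks \<kappa> = {h \<in> G. 0 < h}"
proof -
  let ?H = "{h \<in> G. 0 < h}"
  obtain \<kappa> where \<kappa>: "\<kappa> \<in> partitions" "first_column_hooks \<kappa> = nat ` ?H"
  proof (rule partition_with_first_column_hooks[of "nat ` ?H"])
    show "finite (nat ` ?H)" using finite_pos_G by (rule finite_imageI)
  qed auto
  have hooks: "int ` first_column_hooks \<kappa> = ?H"
    unfolding \<kappa>(2) image_image by (auto simp: image_iff)
  have "card ?H = length \<kappa>"
    using card_first_column_hooks[OF \<kappa>(1)] hooks card_image[of int "first_column_hooks \<kappa>"]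
    by (simp add: inj_on_def)
  \<comment> \<open>Charge zero makes the shift from hooks to beads agree with the shift from
    \<open>G\<close> to the abacus of \<open>\<omega>\<close>.\<close>
  then have len: "int (length \<kappa>) - 1 = - w 1" using card_pos_G by simp
  have "z + int (length \<kappa>) - 1 \<in> G \<longleftrightarrow> \<omega> z \<le> 0" for z
  proof -
    have "z + int (length \<kappa>) - 1 + w 1 = z" using len by simp
    then show ?thesis by (simp only: G_def mem_Collect_eq)
  qed
  then have abacus: "partition_abacus \<kappa> = affine_abacus \<omega>"
    by (simp only: set_eq_iff partition_abacus_iff[OF \<kappa>(1)] hooks pos_G_Un_neg affine_abacus_def
        mem_Collect_eq simp_thms)
  have "z - int n \<in> affine_abacus \<omega>" "z - int p \<in> affine_abacus \<omega>" if "z \<in> affine_abacus \<omega>" for z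
    using G_closed_n[of "z - w 1"] G_closed_p[OF assms, of "z - w 1"] that
    by (simp_all add: G_def affine_abacus_def algebra_simps)
  then have "\<kappa> \<in> cores n p" by (intro in_cores_if_abacus_closed \<kappa>(1)) (simp_all only: abacus)
  then show ?thesis using that abacus hooks by blast
qed

end

section \<open>The Anderson map\<close>

lemma anderson_core_eqI:
  assumes "\<kappa> \<in> partitions" "int ` first_column_hooks \<kappa> = pos_labels_below n p x"
  shows "anderson_core n p x = \<kappa>"
  unfolding anderson_core_def
proof (rule the_equality)
  fix \<mu>
  assume \<mu>: "\<mu> \<in> partitions \<and> int ` first_column_hooks \<mu> = pos_labels_below n p x"
  then have "int ` first_column_hooks \<mu> = int ` first_column_hooks \<kappa>" using assms(2) by simp
  then have "first_column_hooks \<mu> = first_column_hooks \<kappa>" by (simp add: inj_image_eq_iff)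
  then show "\<mu> = \<kappa>" using first_column_hooks_inject assms(1) \<mu> by blast
qed (use assms in blast)

lemma first_column_hooks_anderson_core:
  assumes "x \<in> dyck_paths n p"
  shows "int ` first_column_hooks (anderson_core n p x) = pos_labels_below n p x"
proof -
  let ?H = "pos_labels_below n p x"
  have pos: "0 < h" if "h \<in> ?H" for h using that by (simp add: pos_labels_below_def)
  obtain \<kappa> where \<kappa>: "\<kappa> \<in> partitions" "first_column_hooks \<kappa> = nat ` ?H"
  proof (rule partition_with_first_column_hooks[of "nat ` ?H"])
    show "finite (nat ` ?H)" using finite_pos_labels_below[OF assms] by (rule finite_imageI)
    show "0 \<notin> nat ` ?H" using pos by fastforce
  qed
  have "(\<lambda>h. int (nat h)) ` ?H = (\<lambda>h. h) ` ?H" by (rule image_cong) (use pos in fastforce)+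
  then have "int ` first_column_hooks \<kappa> = ?H" unfolding \<kappa>(2) image_image by simp
  then show ?thesis using anderson_core_eqI \<kappa>(1) by metis
qed

text \<open>The core returns the label set as its first-column hooks, and the label set determines
  the path.\<close>

lemma inj_on_anderson_core:
  assumes "0 < n" "coprime n p"
  shows "inj_on (anderson_core n p) (dyck_paths n p)"
  by (rule inj_onI) (metis assms dyck_path_eqI first_column_hooks_anderson_core)

text \<open>The numbers counted are \<open>a + t * n + e\<close> with \<open>t \<ge> 0\<close>. The
  two upper bounds on \<open>h\<close> become two upper bounds on \<open>t\<close>.\<close>

lemma card_congruent_between:
  fixes a :: int and n q m e r :: nat
  assumes "0 < e" "e < n" "r < n"
  shows "card {h. a < h \<and> h < a + int (q * n + e) \<and> h < a + int (m * n + r) \<and>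
      [h = a + int (q * n + e)] (mod int n)} = min q (if e < r then m + 1 else m)"
proof -
  let ?T = "if e < r then m + 1 else m"
  let ?f = "\<lambda>t. a + int (t * n + e)"
  \<comment> \<open>Both remainders are below \<open>n\<close>, so the comparison is lexicographic:
    the remainders decide when \<open>t = m'\<close>.\<close>
  have lt: "t * n + e < m' * n + r' \<longleftrightarrow> t < (if e < r' then m' + 1 else m')" if "r' < n" for t m' r'
  proof -
    have "t * n + n \<le> m' * n" if "t < m'"
      using mult_le_mono1[of "Suc t" m' n] that by simp
    moreover have "m' * n + n \<le> t * n" if "m' < t"
      using mult_le_mono1[of "Suc m'" t n] that by simp
    ultimately show ?thesis using assms(2) that by (cases t m' rule: linorder_cases) auto
  qed
  have "{h. a < h \<and> h < a + int (q * n + e) \<and> h < a + int (m * n + r) \<and>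
      [h = a + int (q * n + e)] (mod int n)} = ?f ` {..<min q ?T}" (is "?S = _")
  proof (intro set_eqI iffI)
    fix h
    assume "h \<in> ?S"
    then have h: "a < h" "h < a + int (q * n + e)" "h < a + int (m * n + r)"
      "[h = a + int (q * n + e)] (mod int n)" by auto
    from h(4) have "[h - a = int (q * n + e)] (mod int n)"
      by (simp add: cong_iff_dvd_diff algebra_simps)
    then have "[h - a = int e] (mod int n)" by (simp add: cong_def)
    then have "(h - a) mod int n = int e" using assms(2) by (simp add: cong_def)
    then have "h - a = (h - a) div int n * int n + int e" using div_mult_mod_eq by metis
    moreover have "0 \<le> (h - a) div int n" using h(1) assms(2) by (simp add: div_int_pos_iff)
    ultimately have h_eq: "h = ?f (nat ((h - a) div int n))" by simp
    let ?t = "nat ((h - a) div int n)"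
    have "int (?t * n + e) < int (q * n + e)" "int (?t * n + e) < int (m * n + r)"
      using h(2,3) h_eq by linarith+
    then have "?t < q" "?t < ?T"
      using lt[OF assms(2), of ?t q] lt[OF assms(3), of ?t m] by (simp_all only: of_nat_less_iff less_irrefl if_False)
    then show "h \<in> ?f ` {..<min q ?T}" using h_eq by (intro image_eqI[of _ _ ?t]) simp_all
  next
    fix h
    assume "h \<in> ?f ` {..<min q ?T}"
    then obtain t where "h = ?f t" "t < min q ?T" by (elim imageE) (simp only: lessThan_iff)
    then have t: "h = ?f t" "t < q" "t < ?T" by (simp_all only: min_less_iff_conj)
    have "t * n + e < q * n + e" "t * n + e < m * n + r"
      using lt[OF assms(2), of t q] lt[OF assms(3), of t m] t(2,3) by (simp_all only: less_irrefl if_False)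
    then have "int (t * n + e) < int (q * n + e)" "int (t * n + e) < int (m * n + r)"
      by (simp_all only: of_nat_less_iff)
    moreover have "[?f t = a + int (q * n + e)] (mod int n)"
      by (intro cong_add) (simp_all add: cong_def)
    moreover have "0 < int (t * n + e)" using assms(1) by (simp only: of_nat_0_less_iff add_gr_0 simp_thms)
    ultimately show "h \<in> ?S" unfolding t(1) mem_Collect_eq by linarith
  qed
  moreover have "inj_on ?f {..<min q ?T}" using assms(2) by (auto intro!: inj_onI)
  ultimately show ?thesis by (simp only: card_image card_lessThan)
qed

context dominant_permutation
begin

text \<open>The path built from \<open>G\<close> and the core built from \<open>G\<close> share the
  positive part of \<open>G\<close> as labels and hooks. Uniqueness of the core and injectivity of
  \<open>anderson_core\<close> identify this path as the image of \<open>\<omega>\<close>.\<close>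

lemma anderson_map:
  assumes "coprime n p" "p_stable p \<omega>"
  shows "anderson_map n p \<omega> \<in> dyck_paths n p"
    and "pos_labels_below n p (anderson_map n p \<omega>) = {h \<in> G. 0 < h}"
proof -
  obtain \<kappa> where \<kappa>: "\<kappa> \<in> cores n p" "partition_abacus \<kappa> = affine_abacus \<omega>"
    "int ` first_column_hooks \<kappa> = {h \<in> G. 0 < h}"
    using core_exists[OF assms(2)] by blast
  then have part: "\<kappa> \<in> partitions" by (simp add: cores_def)
  have the_core: "(THE \<kappa>. \<kappa> \<in> cores n p \<and> partition_abacus \<kappa> = affine_abacus \<omega>) = \<kappa>"
  proof (rule the_equality)
    fix \<mu>
    assume "\<mu> \<in> cores n p \<and> partition_abacus \<mu> = affine_abacus \<omega>"
    then have "\<mu> \<in> partitions" "partition_abacus \<mu> = partition_abacus \<kappa>"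
      using \<kappa>(2) by (auto simp: cores_def)
    then show "\<mu> = \<kappa>" using partition_abacus_inject part by blast
  qed (use \<kappa> in blast)
  obtain x where x: "x \<in> dyck_paths n p" "pos_labels_below n p x = {h \<in> G. 0 < h}"
    using dyck_path_exists[OF n_pos assms(1) G_neg G_zero G_closed_n G_closed_p[OF assms(2)]]
    by blast
  have "anderson_core n p x = \<kappa>" using anderson_core_eqI part \<kappa>(3) x(2) by simp
  then have "anderson_map n p \<omega> = x"
    unfolding anderson_map_def the_core
    using the_inv_into_f_eq inj_on_anderson_core[OF n_pos assms(1)] x(1) by metis
  then show "anderson_map n p \<omega> \<in> dyck_paths n p"
    "pos_labels_below n p (anderson_map n p \<omega>) = {h \<in> G. 0 < h}"
    using x by auto
qed

text \<open>A number \<open>z\<close> is minimal outside \<open>G\<close> in its class exactly when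
  \<open>\<omega> (z + w 1)\<close> lies in the window \<open>1..n\<close>. Dominance lists these
  numbers in increasing order.\<close>

lemma north_label_anderson_map:
  assumes "coprime n p" "p_stable p \<omega>" "i \<in> {1..n}"
  shows "north_label n p (anderson_map n p \<omega>) i = w (int i) - w 1"
proof -
  let ?x = "anderson_map n p \<omega>" and ?f = "\<lambda>k. w (int k + 1) - w 1"
  have "label n p ` north_starts ?x = {z. z \<notin> G \<and> z - int n \<in> G}"
    using north_labels_eq[OF n_pos assms(1) anderson_map(1)[OF assms(1,2)]]
    unfolding anderson_map(2)[OF assms(1,2)] pos_G_Un_neg .
  also have "\<dots> = ?f ` {..<n}"
  proof (intro set_eqI iffI)
    fix z
    assume "z \<in> {z. z \<notin> G \<and> z - int n \<in> G}"
    then have z: "0 < \<omega> (z + w 1)" "\<omega> (z + w 1) \<le> int n"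
      using shift[of "z + w 1" "- 1"] by (auto simp: G_def algebra_simps)
    have "z = w (\<omega> (z + w 1)) - w 1" by simp
    then show "z \<in> ?f ` {..<n}"
      using z by (intro image_eqI[of _ _ "nat (\<omega> (z + w 1) - 1)"]) auto
  next
    fix z
    assume "z \<in> ?f ` {..<n}"
    then obtain k where k: "k < n" "z = ?f k" by auto
    then have "\<omega> (z + w 1) = int k + 1" by simp
    moreover have "\<omega> (z - int n + w 1) = \<omega> (z + w 1) - int n"
      using shift[of "z + w 1" "- 1"] by (simp add: algebra_simps)
    ultimately show "z \<in> {z. z \<notin> G \<and> z - int n \<in> G}" using k(1) by (simp add: G_def)
  qed
  finally have labels: "label n p ` north_starts ?x = set (map ?f [0..<n])" by (simp add: atLeast0LessThan)
  have "sorted_wrt (<) (map ?f [0..<n])"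
    by (auto simp: sorted_wrt_iff_nth_less intro: w_less)
  then have "sorted_list_of_set (set (map ?f [0..<n])) = map ?f [0..<n]"
    by (simp only: strict_sorted_iff sorted_list_of_set.idem_if_sorted_distinct)
  then have "north_label n p ?x i = map ?f [0..<n] ! (i - 1)"
    by (simp only: north_label_def labels)
  also have "\<dots> = w (int i) - w 1"
  proof -
    have "i - 1 < n" "int (i - 1) + 1 = int i" using assms(3) by auto
    then show ?thesis by simp
  qed
  finally show ?thesis .
qed

text \<open>If \<open>h + w 1 = w j + k * n\<close>, then \<open>\<omega>\<close> takes it to
  \<open>j + k * n\<close>, which is nonpositive exactly for negative \<open>k\<close>.\<close>

lemma mem_G_iff_if_cong:
  assumes "j \<in> {1..int n}" "[h + w 1 = w j] (mod int n)"
  shows "h \<in> G \<longleftrightarrow> h < w j - w 1"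
proof -
  have "int n dvd h + w 1 - w j" using assms(2) by (simp add: cong_iff_dvd_diff)
  then obtain k where "h + w 1 - w j = int n * k" by (rule dvdE)
  then have k: "h + w 1 = w j + k * int n" by (simp add: algebra_simps)
  then have "\<omega> (h + w 1) = j + k * int n" by (simp add: shift)
  then have "h \<in> G \<longleftrightarrow> k < 0" using window_nonpos_iff[OF assms(1)] by (simp add: G_def)
  also have "\<dots> \<longleftrightarrow> k * int n < 0" using n_pos by (simp add: mult_less_0_iff)
  also have "\<dots> \<longleftrightarrow> h < w j - w 1" using k by linarith
  finally show ?thesis .
qed

text \<open>The lower bound \<open>w i - w 1\<close> is nonnegative and so contains positivity; on
  the class of \<open>w j - w 1\<close>, membership in \<open>G\<close> is an upper bound.\<close>

lemma codinv_tableau_anderson_map: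
  assumes "coprime n p" "p_stable p \<omega>" "i \<in> {1..n}" "j \<in> {1..n}"
  shows "codinv_tableau n p (anderson_map n p \<omega>) i j =
    card {h. w (int i) - w 1 < h \<and> h < w (int j) - w 1 \<and> h < w (int i) - w 1 + int p \<and>
      [h = w (int j) - w 1] (mod int n)}"
proof -
  note labels = north_label_anderson_map[OF assms(1,2)]
  have "0 \<le> w (int i) - w 1" using w_1_le[of "int i"] assms(3) by simp
  moreover have "h \<in> G \<longleftrightarrow> h < w (int j) - w 1" if "[h = w (int j) - w 1] (mod int n)" for h
    using mem_G_iff_if_cong[of "int j" h] that assms(4) by (simp add: cong_iff_dvd_diff algebra_simps)
  ultimately show ?thesis
    unfolding codinv_tableau_def labels[OF assms(3)] labels[OF assms(4)]
      anderson_map(2)[OF assms(1,2)]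
    by (intro arg_cong[where f = card]) auto
qed

text \<open>Only when the gap \<open>w j - w i\<close> is congruent to \<open>p\<close> do the two tableaux cap the entry
  differently, at \<open>m + 1\<close> and at \<open>m\<close>; there \<open>p\<close>-stability makes both caps void.\<close>

lemma gap_le_if_cong:
  assumes "p_stable p \<omega>" "1 \<le> i" "j \<in> {1..int n}" "[w j = w i + int p] (mod int n)"
  shows "w j \<le> w i + int p"
proof -
  \<comment> \<open>Stability at the position \<open>w i\<close> puts a positive value at
    \<open>w i + p\<close>, hence a gap there.\<close>
  have "i < \<omega> (w i + int p)" using assms(1) unfolding p_stable_def by (metis \<omega>_w)
  then have "w i + int p - w 1 \<notin> G" using assms(2) by (simp add: G_def)
  then show ?thesis using mem_G_iff_if_cong[OF assms(3), of "w i + int p - w 1"] cong_sym[OF assms(4)] by simp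
qed

end

theorem theorem3p2:
  fixes n p :: nat and \<omega> :: "int \<Rightarrow> int"
  assumes "0 < n" and "0 < p" and "coprime n p"
    and "\<omega> \<in> affine_permutations n" and "dominant n \<omega>" and "p_stable p \<omega>"
  shows "\<forall>i\<in>{1..n}. \<forall>j\<in>{1..n}. i < j \<longrightarrow>
           shi_tableau n p \<omega> i j = codinv_tableau n p (anderson_map n p \<omega>) i j"
proof (intro ballI impI)
  fix i j
  assume i: "i \<in> {1..n}" and j: "j \<in> {1..n}" and "i < j"
  interpret dominant_permutation n \<omega> using assms by unfold_locales
  define m r where "m = p div n" and "r = p mod n"
  have p: "p = m * n + r" and r: "r < n" using assms(1) by (simp_all add: m_def r_def)
  define s where "s = residue_perm n \<omega>"
  have s: "s k \<in> {1..n}" "[int (s k) = w (int k)] (mod int n)" if "k \<in> {1..n}" for k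
    unfolding s_def
    using that permutes_in_image[OF conjunct1[OF residue_perm], of k] bspec[OF conjunct2[OF residue_perm]]
    by simp_all
  define D where "D = nat (w (int j) - w (int i))"
  \<comment> \<open>Dominance makes the gap positive, so \<open>shi_k\<close> is its quotient by
    \<open>n\<close> computed in the naturals.\<close>
  have D: "int D = w (int j) - w (int i)" "0 < D"
    using w_less[of "int i" "int j"] i j \<open>i < j\<close> by (auto simp: D_def)
  define q e where "q = D div n" and "e = D mod n"
  have D_eq: "D = q * n + e" and e: "e < n" using assms(1) by (simp_all add: q_def e_def)
  have shi_k: "shi_k n \<omega> i j = q"
    unfolding shi_k_def D(1)[symmetric] q_def by (simp flip: of_nat_div)
  have "[int (s j) - int (s i) = int D] (mod int n)"
    unfolding D(1) using s(2) i j by (intro cong_diff) auto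
  then have "int n dvd int (s j) - int (s i) - int D" by (simp add: cong_iff_dvd_diff)
  then obtain k where "int (s j) - int (s i) - int D = int n * k" by (rule dvdE)
  then have s_gap: "int (s j) + - (k + int q) * int n = int (s i) + int e"
    unfolding D_eq by (simp add: algebra_simps)
  \<comment> \<open>A gap divisible by \<open>n\<close> would make \<open>j\<close> and
    \<open>i\<close> congruent, although they are distinct elements of the window.\<close>
  have "e \<noteq> 0"
  proof
    assume "e = 0"
    then have "w (int j) = w (int i + int q * int n)"
      unfolding w_shift using D(1) D_eq by (simp add: algebra_simps)
    then have "int j + 0 * int n = int i + int q * int n" by simp
    then show False using window_unique[of "int j" n "int i" 0 "int q"] i j \<open>i < j\<close> by simp
  qed
  \<comment> \<open>Both values lie in \<open>1..n\<close>, so adding \<open>e\<close> to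
    \<open>s i\<close> wraps around at most once.\<close>
  have s_cases: "s j = s i + e \<or> s j + n = s i + e"
  proof (cases "s i + e \<le> n")
    case True
    then have "int (s j) + - (k + int q) * int n = int (s i + e) + 0 * int n" using s_gap by simp
    then show ?thesis
      using window_unique[of "int (s j)" n "int (s i + e)" "- (k + int q)" 0] s(1)[OF i] s(1)[OF j] True
      by simp
  next
    case False
    then have "int (s j) + - (k + int q) * int n = int (s i + e - n) + 1 * int n"
      using s_gap by (simp add: of_nat_diff)
    then show ?thesis
      using window_unique[of "int (s j)" n "int (s i + e - n)" "- (k + int q)" 1]
        s(1)[OF i] s(1)[OF j] False e by auto
  qed
  \<comment> \<open>Without wrapping only the first alternative can hold, with wrapping only the
    second; each then says \<open>r < e\<close>.\<close>
  have cond: "r + s i < s j \<or> (int (s i) + int r - int n < int (s j) \<and> s j < s i) \<longleftrightarrow> r < e"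
    using s_cases e r \<open>e \<noteq> 0\<close> s(1)[OF i] s(1)[OF j] by auto
  have void: "q \<le> m" if "e = r"
  proof -
    have "[w (int j) = w (int i) + int p] (mod int n)"
    proof -
      have "w (int j) - (w (int i) + int p) = int n * (int q - int m)"
        using D(1) D_eq p that by (simp add: algebra_simps)
      then show ?thesis by (simp add: cong_iff_dvd_diff)
    qed
    then have "int D \<le> int p"
      using gap_le_if_cong[OF assms(6), of "int i" "int j"] i j D(1) by simp
    then have "D \<le> p" by simp
    then have "q * n \<le> m * n" using D_eq p that by linarith
    then show ?thesis using assms(1) by simp
  qed
  have gap: "w (int j) - w 1 = w (int i) - w 1 + int (q * n + e)" using D(1) D_eq by simp
  have "codinv_tableau n p (anderson_map n p \<omega>) i j = min q (if e < r then m + 1 else m)"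
    unfolding codinv_tableau_anderson_map[OF assms(3,6) i j] gap
    using card_congruent_between[of e n r "w (int i) - w 1" q m] \<open>e \<noteq> 0\<close> e r
    by (simp only: p[symmetric] neq0_conv)
  \<comment> \<open>For \<open>r < e\<close> both caps are \<open>m\<close>, for
    \<open>e < r\<close> both are \<open>m + 1\<close>; for \<open>e = r\<close> they differ, but
    \<open>q \<le> m\<close> makes both minima \<open>q\<close>.\<close>
  also have "\<dots> = shi_tableau n p \<omega> i j"
    unfolding shi_tableau_def Let_def m_def[symmetric] r_def[symmetric] s_def[symmetric] cond shi_k
    using void by (cases e r rule: linorder_cases) auto
  finally show "shi_tableau n p \<omega> i j = codinv_tableau n p (anderson_map n p \<omega>) i j" by simp
qed

end
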